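(* There are TRSs that are polynomially terminating over $\mathbb{N}$ but are not polynomially terminating over $\mathbb{R}$ and not polynomially terminating over $\mathbb{Q}$.
   Context: A polynomial interpretation over $\mathbb{N}$ for a signature $\mathcal{F}$ assigns to each $n$-ary $f$ a polynomial $f_\mathbb{N} \in \mathbb{Z}[x_1,\dots,x_n]$ such that $f_\mathbb{N}(\mathbb{N}^n) \subseteq \mathbb{N}$ and $f_\mathbb{N}$ is strictly monotone in every argument with respect to the standard order $>$ on $\mathbb{N}$; it is compatible with a TRS $\mathcal{R}$ if $[\alpha](\ell) > [\alpha](r)$ for every rule $\ell \to r$ and every assignment $\alpha$ of variables into $\mathbb{N}$; $\mathcal{R}$ is polynomially terminating over $\mathbb{N}$ if such a compatible interpretation exists. For $D \in \{\mathbb{Q},\mathbb{R}\}$, with $D_0 = \{x\in D : x\ge 0\}$: a polynomial interpretation over $D$ consists of $\delta \in D$, $\delta>0$, and polynomials $f_D \in D[x_1,\dots,x_n]$ with $f_D(D_0^n) \subseteq D_0$; define $x >_{D_0,\delta} y$ iff $x - y \ge \delta$; it is strictly monotone if every $f_D$ is monotone in each argument w.r.t. $>_{D_0,\delta}$ on $D_0$, and compatible with $\mathcal{R}$ if $[\alpha](\ell) >_{D_0,\delta} [\alpha](r)$ for all rules and all assignments into $D_0$; $\mathcal{R}$ is polynomially terminating over $D$ if there is a strictly monotone compatible polynomial interpretation over $D$. *)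

theory Defs
  imports Complex_Main "HOL-Library.Poly_Mapping"
begin

datatype ('f, 'v) trm = Var 'v | Fun 'f "('f, 'v) trm list"

fun vars_trm :: "('f, 'v) trm \<Rightarrow> 'v set" where
  "vars_trm (Var x) = {x}"
| "vars_trm (Fun f ts) = (\<Union>t \<in> set ts. vars_trm t)"

text \<open>A signature is a set \<open>F\<close> of function symbols together with an arity function \<open>ar\<close>.\<close>

fun wf_trm :: "'f set \<Rightarrow> ('f \<Rightarrow> nat) \<Rightarrow> ('f, 'v) trm \<Rightarrow> bool" where
  "wf_trm F ar (Var x) \<longleftrightarrow> True"
| "wf_trm F ar (Fun f ts) \<longleftrightarrow> f \<in> F \<and> length ts = ar f \<and> (\<forall>t \<in> set ts. wf_trm F ar t)"

type_synonym ('f, 'v) rule = "('f, 'v) trm \<times> ('f, 'v) trm"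

definition trs :: "'f set \<Rightarrow> ('f \<Rightarrow> nat) \<Rightarrow> ('f, 'v) rule set \<Rightarrow> bool" where
  "trs F ar R \<longleftrightarrow> finite F \<and> finite R \<and>
     (\<forall>(l, r) \<in> R. wf_trm F ar l \<and> wf_trm F ar r \<and>
        (\<nexists>x. l = Var x) \<and> vars_trm r \<subseteq> vars_trm l)"

text \<open>Multivariate polynomials as finitely supported maps from monomials (finitely supported
  exponent vectors) to coefficients; the indeterminates of an \<open>n\<close>-variate polynomial are
  numbered \<open>0, \<dots>, n - 1\<close>.\<close>

type_synonym 'a mpoly = "(nat \<Rightarrow>\<^sub>0 nat) \<Rightarrow>\<^sub>0 'a"

definition eval_mpoly :: "'a::comm_ring_1 mpoly \<Rightarrow> (nat \<Rightarrow> 'a) \<Rightarrow> 'a" where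
  "eval_mpoly p x =
     (\<Sum>m \<in> Poly_Mapping.keys p. Poly_Mapping.lookup p m *
        (\<Prod>i \<in> Poly_Mapping.keys m. x i ^ Poly_Mapping.lookup m i))"

definition in_vars :: "nat \<Rightarrow> 'a::comm_ring_1 mpoly \<Rightarrow> bool" where
  "in_vars n p \<longleftrightarrow> (\<forall>m \<in> Poly_Mapping.keys p. Poly_Mapping.keys m \<subseteq> {..<n})"

definition maps_into :: "'a::comm_ring_1 set \<Rightarrow> nat \<Rightarrow> 'a mpoly \<Rightarrow> bool" where
  "maps_into C n p \<longleftrightarrow> (\<forall>x. (\<forall>i<n. x i \<in> C) \<longrightarrow> eval_mpoly p x \<in> C)"

definition monotone_args ::
  "'a::comm_ring_1 set \<Rightarrow> ('a \<Rightarrow> 'a \<Rightarrow> bool) \<Rightarrow> nat \<Rightarrow> 'a mpoly \<Rightarrow> bool" where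
  "monotone_args C gt n p \<longleftrightarrow>
     (\<forall>x. (\<forall>i<n. x i \<in> C) \<longrightarrow>
        (\<forall>i<n. \<forall>y \<in> C. gt y (x i) \<longrightarrow> gt (eval_mpoly p (x(i := y))) (eval_mpoly p x)))"

text \<open>The default value \<open>0\<close> beyond the last argument is irrelevant for well-formed terms.\<close>

fun eval_trm :: "('f \<Rightarrow> 'a::comm_ring_1 mpoly) \<Rightarrow> ('v \<Rightarrow> 'a) \<Rightarrow> ('f, 'v) trm \<Rightarrow> 'a" where
  "eval_trm I \<alpha> (Var x) = \<alpha> x"
| "eval_trm I \<alpha> (Fun f ts) =
     eval_mpoly (I f) (\<lambda>i. if i < length ts then map (eval_trm I \<alpha>) ts ! i else 0)"

definition compatible ::
  "'a::comm_ring_1 set \<Rightarrow> ('a \<Rightarrow> 'a \<Rightarrow> bool) \<Rightarrow> ('f \<Rightarrow> 'a mpoly) \<Rightarrow> ('f, 'v) rule set \<Rightarrow> bool" where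
  "compatible C gt I R \<longleftrightarrow>
     (\<forall>(l, r) \<in> R. \<forall>\<alpha>. (\<forall>v. \<alpha> v \<in> C) \<longrightarrow> gt (eval_trm I \<alpha> l) (eval_trm I \<alpha> r))"

text \<open>The natural numbers are the subset \<open>\<nat>\<close> of \<open>int\<close>, since the polynomials have
  integer (possibly negative) coefficients.\<close>

definition poly_terminating_nat ::
  "'f set \<Rightarrow> ('f \<Rightarrow> nat) \<Rightarrow> ('f, 'v) rule set \<Rightarrow> bool" where
  "poly_terminating_nat F ar R \<longleftrightarrow>
     (\<exists>I :: 'f \<Rightarrow> int mpoly.
        (\<forall>f \<in> F. in_vars (ar f) (I f) \<and> maps_into \<nat> (ar f) (I f) \<and>
           monotone_args \<nat> (>) (ar f) (I f)) \<and>
        compatible \<nat> (>) I R)"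

definition gt_delta :: "'a::linordered_field \<Rightarrow> 'a \<Rightarrow> 'a \<Rightarrow> bool" where
  "gt_delta \<delta> x y \<longleftrightarrow> x - y \<ge> \<delta>"

text \<open>Used with \<open>TYPE(rat)\<close> and \<open>TYPE(real)\<close>.\<close>

definition poly_terminating_field ::
  "'a::linordered_field itself \<Rightarrow> 'f set \<Rightarrow> ('f \<Rightarrow> nat) \<Rightarrow> ('f, 'v) rule set \<Rightarrow> bool" where
  "poly_terminating_field D F ar R \<longleftrightarrow>
     (\<exists>(\<delta>::'a) (I :: 'f \<Rightarrow> 'a mpoly). \<delta> > 0 \<and>
        (\<forall>f \<in> F. in_vars (ar f) (I f) \<and> maps_into {0..} (ar f) (I f) \<and>
           monotone_args {0..} (gt_delta \<delta>) (ar f) (I f)) \<and>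
        compatible {0..} (gt_delta \<delta>) I R)"

end

theory Submission
  imports Defs "HOL-Computational_Algebra.Polynomial"
begin

text \<open>Over the naturals take \<open>0 = 0\<close>, \<open>s(x) = x + 1\<close>, \<open>g(x) = 3x + 2\<close> and
  \<open>f(x) = 9x(x - 1) + x + 1\<close>; the last polynomial exceeds \<open>x\<close> at every natural number,
  but not at \<open>1/2\<close>. The rules force this shape over every ordered field: comparing degrees and
  leading coefficients gives \<open>s(x) = x + t\<close>, \<open>g\<close> linear of slope greater than \<open>1\<close>, and
  \<open>f\<close> of degree at most \<open>2\<close> (because \<open>f(g(g(x)))\<close> is dominated by \<open>g\<^sup>5(f(x + 2t))\<close>).
  If \<open>z\<close> interprets the constant, the ground rules bound the quadratic \<open>d(x) = f(x) - x\<close>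
  from above at \<open>z\<close> and \<open>z + t\<close> and from below at \<open>z + 2t\<close> so that Lagrange interpolation
  makes \<open>d(z + t/2)\<close> negative, contradicting the rule \<open>f(x) \<rightarrow> x\<close>.\<close>

section \<open>Asymptotic comparison of polynomials\<close>

text \<open>Induction along the Horner form with an explicit threshold takes the place of limits, so
  any ordered field is covered. The summand \<open>\<bar>a\<bar> / ?c\<close> absorbs the new
  constant term \<open>a\<close>.\<close>

lemma poly_ge_lead_coeff:
  fixes p :: "'a::linordered_field poly"
  assumes "lead_coeff p > 0"
  shows "\<exists>n. \<forall>x\<ge>n. poly p x \<ge> lead_coeff p"
  using assms
proof (induction p)
  case 0
  then show ?case by simp
next
  case (pCons a p)
  show ?case
  proof (cases "p = 0")
    case True
    then show ?thesis by simp
  next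
    case False
    let ?c = "lead_coeff p"
    have c: "?c > 0" using pCons.prems False by simp
    then obtain n where n: "\<And>x. x \<ge> n \<Longrightarrow> poly p x \<ge> ?c" using pCons.IH by blast
    have "poly (pCons a p) x \<ge> ?c" if x: "x \<ge> max n (1 + \<bar>a\<bar> / ?c)" for x
    proof -
      have "?c + \<bar>a\<bar> = (1 + \<bar>a\<bar> / ?c) * ?c" using c False by (simp add: distrib_right)
      also have "\<dots> \<le> x * poly p x"
        using x n[of x] c by (intro mult_mono) (auto intro: order_trans[rotated])
      finally show ?thesis by (simp add: abs_if split: if_splits)
    qed
    then show ?thesis
      using False by (intro exI[of _ "max n (1 + \<bar>a\<bar> / ?c)"]) simp
  qed
qed

lemma lead_coeff_nonneg:
  fixes p :: "'a::linordered_field poly"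
  assumes "\<And>x. x \<ge> 0 \<Longrightarrow> poly p x \<ge> 0"
  shows "lead_coeff p \<ge> 0"
proof (rule ccontr)
  assume "\<not> lead_coeff p \<ge> 0"
  then have neg: "lead_coeff (- p) > 0" by (simp add: lead_coeff_minus)
  then obtain n where n: "\<And>x. x \<ge> n \<Longrightarrow> poly (- p) x \<ge> lead_coeff (- p)"
    using poly_ge_lead_coeff by blast
  have "poly (- p) (max n 0) > 0" using n[of "max n 0"] neg by (meson max.cobounded1 less_le_trans)
  then show False using assms[of "max n 0"] by simp
qed

text \<open>Both claims come from the sign of the leading coefficient of \<open>p - q\<close>: it is
  nonnegative, yet would be negative if \<open>q\<close> won in degree, or in leading coefficient at
  equal degree.\<close>

lemma dominated_poly:
  fixes p q :: "'a::linordered_field poly"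
  assumes le: "\<And>x. x \<ge> 0 \<Longrightarrow> poly q x \<le> poly p x" and q: "lead_coeff q > 0"
  shows "degree q \<le> degree p"
    and "degree q = degree p \<Longrightarrow> lead_coeff q \<le> lead_coeff p"
proof -
  have nn: "lead_coeff (p - q) \<ge> 0" by (rule lead_coeff_nonneg) (simp add: le)
  show deg: "degree q \<le> degree p"
  proof (rule ccontr)
    assume "\<not> ?thesis"
    then have lt: "degree p < degree q" by simp
    have "degree (p - q) = degree q"
      using degree_add_eq_right[of p "- q"] lt by simp
    then have "lead_coeff (p - q) = - lead_coeff q" using lt by (simp add: coeff_eq_0)
    then show False using nn q by simp
  qed
  assume eq: "degree q = degree p"
  show "lead_coeff q \<le> lead_coeff p"
  proof (rule ccontr)
    assume "\<not> ?thesis"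
    then have neg: "coeff (p - q) (degree q) < 0" using eq by simp
    then have "degree (p - q) \<ge> degree q" by (intro le_degree) simp
    moreover have "degree (p - q) \<le> degree q" using degree_diff_le[of p "degree q" q] eq by simp
    ultimately show False using nn neg by simp
  qed
qed

lemma coeff_pcompose_top:
  fixes p q :: "'a::linordered_field poly"
  assumes "degree q > 0"
  shows "coeff (p \<circ>\<^sub>p q) (degree p * degree q) = lead_coeff p * lead_coeff q ^ degree p"
  using lead_coeff_comp[OF assms, of p] by (simp add: degree_pcompose)

lemma lead_coeff_pcompose_pos:
  fixes p q :: "'a::linordered_field poly"
  assumes "degree q > 0" "lead_coeff p > 0" "lead_coeff q > 0"
  shows "lead_coeff (p \<circ>\<^sub>p q) > 0"
  using assms by (simp add: lead_coeff_comp)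

section \<open>Strictly monotone polynomials over ordered fields\<close>

lemma monotone_poly_pos:
  fixes p :: "'a::linordered_field poly"
  assumes \<delta>: "\<delta> > 0"
    and nonneg: "\<And>x. x \<ge> 0 \<Longrightarrow> poly p x \<ge> 0"
    and mono: "\<And>x y. x \<ge> 0 \<Longrightarrow> y - x \<ge> \<delta> \<Longrightarrow> poly p y - poly p x \<ge> \<delta>"
  shows "degree p > 0" and "lead_coeff p > 0"
proof -
  show deg: "degree p > 0"
  proof (rule ccontr)
    assume "\<not> ?thesis"
    then obtain c where "p = [:c:]" by (meson degree_eq_zeroE gr0I)
    then show False using mono[of 0 \<delta>] \<delta> by simp
  qed
  then have "lead_coeff p \<noteq> 0" by auto
  then show "lead_coeff p > 0" using lead_coeff_nonneg[of p] nonneg by (simp add: less_le)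
qed

lemma monotone_linear_slope:
  fixes a :: "'a::linordered_field"
  assumes "\<delta> > 0" "poly [:b, a:] \<delta> - poly [:b, a:] 0 \<ge> \<delta>"
  shows "a \<ge> 1"
  using assms by simp

lemma degree_le_1_eq: "degree p \<le> Suc 0 \<Longrightarrow> p = [:coeff p 0, coeff p 1:]"
  by (rule poly_eqI) (auto simp: coeff_pCons coeff_eq_0 split: nat.split)

lemma degree_le_2_eq: "degree p \<le> 2 \<Longrightarrow> p = [:coeff p 0, coeff p 1, coeff p 2:]"
  by (rule poly_eqI) (auto simp: coeff_pCons coeff_eq_0 numeral_2_eq_2 split: nat.split)

text \<open>The impossibility freed from terms: the hypotheses \<open>f0\<close> to
  \<open>gf\<close> are the inequalities of the seven rules, and \<open>z\<close> is the value of
  the constant.\<close>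

lemma no_field_interpretation:
  fixes s f g :: "'a::linordered_field poly" and z \<delta> :: 'a
  assumes \<delta>: "\<delta> > 0" and z: "z \<ge> 0"
    and nonneg: "\<And>p x. p \<in> {s, f, g} \<Longrightarrow> x \<ge> 0 \<Longrightarrow> poly p x \<ge> 0"
    and mono: "\<And>p x y. p \<in> {s, f, g} \<Longrightarrow> x \<ge> 0 \<Longrightarrow> y - x \<ge> \<delta> \<Longrightarrow> poly p y - poly p x \<ge> \<delta>"
    and f0: "poly s (poly s z) - poly f z \<ge> \<delta>"
    and f1: "poly s (poly s (poly s z)) - poly f (poly s z) \<ge> \<delta>"
    and f2: "poly f (poly s (poly s z)) - (poly s ^^ 20) z \<ge> \<delta>"
    and fx: "\<And>x. x \<ge> 0 \<Longrightarrow> poly f x - x \<ge> \<delta>"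
    and gs: "\<And>x. x \<ge> 0 \<Longrightarrow> poly g (poly s x) - poly s (poly s (poly g x)) \<ge> \<delta>"
    and fg: "\<And>x. x \<ge> 0 \<Longrightarrow> poly f (poly g x) - poly g (poly g (poly f x)) \<ge> \<delta>"
    and gf: "\<And>x. x \<ge> 0 \<Longrightarrow>
      (poly g ^^ 5) (poly f (poly s (poly s x))) - poly f (poly g (poly g x)) \<ge> \<delta>"
  shows False
proof -
  have pos: "degree p > 0" "lead_coeff p > 0" if "p \<in> {s, f, g}" for p
    using monotone_poly_pos[OF \<delta>, of p] nonneg[OF that] mono[OF that] by blast+
  note pos_s = pos[of s, simplified] and pos_f = pos[of f, simplified] and pos_g = pos[of g, simplified]
  \<comment> \<open>Degrees multiply under composition, so \<open>g\<close> occurring twice on the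
    left and once on the right forces degree at most 1.\<close>
  have "degree (g \<circ>\<^sub>p (g \<circ>\<^sub>p f)) \<le> degree (f \<circ>\<^sub>p g)"
  proof (rule dominated_poly)
    show "poly (g \<circ>\<^sub>p (g \<circ>\<^sub>p f)) x \<le> poly (f \<circ>\<^sub>p g) x" if "x \<ge> 0" for x
      using fg[OF that] \<delta> by (simp add: poly_pcompose)
  qed (intro lead_coeff_pcompose_pos; use pos_f pos_g in \<open>simp add: degree_pcompose\<close>)
  then have "degree g \<le> Suc 0" using pos_f pos_g by (simp add: degree_pcompose)
  then obtain g0 g1 where g: "g = [:g0, g1:]" using degree_le_1_eq by blast
  have g1: "g1 \<ge> 1" using monotone_linear_slope[OF \<delta>, of g0 g1] mono[of g 0 \<delta>] g by simp
  have s_le: "poly (s \<circ>\<^sub>p (s \<circ>\<^sub>p g)) x \<le> poly (g \<circ>\<^sub>p s) x" if "x \<ge> 0" for x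
    using gs[OF that] \<delta> by (simp add: poly_pcompose)
  have s_pos: "lead_coeff (s \<circ>\<^sub>p (s \<circ>\<^sub>p g)) > 0"
    using pos_s pos_g by (intro lead_coeff_pcompose_pos) (simp_all add: degree_pcompose)
  have "degree s \<le> Suc 0" using dominated_poly(1)[OF s_le s_pos] pos_s pos_g by (simp add: degree_pcompose)
  then obtain t s1 where s: "s = [:t, s1:]" using degree_le_1_eq by blast
  have s1: "s1 \<ge> 1" using monotone_linear_slope[OF \<delta>, of t s1] mono[of s 0 \<delta>] s by simp
  \<comment> \<open>Both sides of \<open>s_le\<close> are now linear, so their slopes are
    comparable.\<close>
  have "s1 * (s1 * g1) \<le> g1 * s1"
    using dominated_poly(2)[OF s_le s_pos] s1 g1 by (simp add: s g pcompose_pCons)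
  then have "s1 = 1" using s1 g1 by (simp add: mult.commute)
  with s have s: "poly s = (\<lambda>x. x + t)" by (auto simp: add.commute)
  have s_iter: "(poly s ^^ n) x = x + of_nat n * t" for n x
    by (induction n) (simp_all add: s algebra_simps)
  \<comment> \<open>The value of \<open>f\<close> at \<open>z\<close> lies between
    \<open>z + \<delta>\<close> and \<open>z + 2 * t - \<delta>\<close>.\<close>
  have t: "t > 0" using f0 fx[OF z] \<delta> by (simp add: s)
  \<comment> \<open>This yields slope above 2; a slope above 1 suffices for comparing exponents
    later.\<close>
  have "g1 * t \<ge> 2 * t + \<delta>" using gs[of 0] by (simp add: s g algebra_simps)
  then have "(g1 - 2) * t > 0" using \<delta> by (simp add: algebra_simps)
  then have g1': "g1 > 1" using t by (simp add: zero_less_mult_iff)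
  \<comment> \<open>\<open>?u\<close> is \<open>s\<close> applied twice, and \<open>?L\<close> is
    the left side of \<open>gf\<close>.\<close>
  let ?u = "[:2 * t, 1:]"
  let ?L = "g \<circ>\<^sub>p (g \<circ>\<^sub>p (g \<circ>\<^sub>p (g \<circ>\<^sub>p (g \<circ>\<^sub>p (f \<circ>\<^sub>p ?u)))))"
  have f_le: "poly (f \<circ>\<^sub>p (g \<circ>\<^sub>p g)) x \<le> poly ?L x" if "x \<ge> 0" for x
    using gf[OF that] \<delta> by (simp add: poly_pcompose s eval_nat_numeral add_ac)
  have f_pos: "lead_coeff (f \<circ>\<^sub>p (g \<circ>\<^sub>p g)) > 0"
    using pos_f pos_g by (intro lead_coeff_pcompose_pos) (simp_all add: degree_pcompose)
  have dg: "degree g = 1" and lg: "lead_coeff g = g1" using g g1 by auto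
  have deg_comp: "degree (g \<circ>\<^sub>p q) = degree q" for q using dg by (simp add: degree_pcompose)
  have coeff_comp: "coeff (g \<circ>\<^sub>p q) n = g1 * coeff q n" if "degree q = n" "n > 0" for q n
    using coeff_pcompose_top[of q g] that unfolding lg by (simp add: dg)
  have deg_u: "degree (f \<circ>\<^sub>p ?u) = degree f" by (simp add: degree_pcompose)
  have coeff_u: "coeff (f \<circ>\<^sub>p ?u) (degree f) = lead_coeff f"
    using coeff_pcompose_top[of ?u f] by simp
  have lL: "lead_coeff ?L = g1 ^ 5 * lead_coeff f"
    by (simp only: deg_comp coeff_comp deg_u coeff_u pos_f) (simp add: eval_nat_numeral)
  have "lead_coeff (g \<circ>\<^sub>p g) = g1 * g1"
    unfolding deg_comp using coeff_comp[OF refl pos_g(1)] lg by simp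
  then have lR: "lead_coeff (f \<circ>\<^sub>p (g \<circ>\<^sub>p g)) = lead_coeff f * (g1 * g1) ^ degree f"
    using lead_coeff_comp[of "g \<circ>\<^sub>p g" f] pos_g(1) unfolding deg_comp by simp
  have "lead_coeff f * (g1 * g1) ^ degree f \<le> g1 ^ 5 * lead_coeff f"
    using dominated_poly(2)[OF f_le f_pos] dg unfolding lL lR by (simp add: degree_pcompose)
  \<comment> \<open>Each \<open>g\<close> under \<open>f\<close> counts \<open>degree f\<close>
    times, each \<open>g\<close> outside only once. The exponent 5 is below 6, which excludes a
    cubic \<open>f\<close>.\<close>
  then have "g1 ^ (2 * degree f) \<le> g1 ^ 5"
    unfolding mult_2 power_add using pos_f by (simp add: power_mult_distrib mult.commute)
  then have "2 * degree f \<le> 5" using g1' power_le_imp_le_exp by blast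
  then have "degree f \<le> 2" by simp
  then obtain a b c where f: "f = [:c, b, a:]" using degree_le_2_eq by blast
  define d where "d x = poly f x - x" for x
  have d0: "d z \<le> 2 * t" using f0 \<delta> by (simp add: d_def s)
  have d1: "d (z + t) \<le> 2 * t" using f1 \<delta> by (simp add: d_def s)
  \<comment> \<open>The 20 copies of \<open>s\<close> minus the 2 in the argument leave 18 = 3 * 2 +
    6 * 2, just enough to make the combination below nonpositive.\<close>
  have d2: "d (z + 2 * t) \<ge> 18 * t" using f2 \<delta> unfolding s_iter by (simp add: d_def s add_ac)
  \<comment> \<open>Lagrange interpolation at \<open>z\<close>, \<open>z + t\<close>,
    \<open>z + 2 * t\<close> has weights 3/8, 6/8, -1/8 at \<open>z + t / 2\<close>.\<close>
  have "8 * d (z + t / 2) = 3 * d z + 6 * d (z + t) - d (z + 2 * t)"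
    by (simp add: d_def f field_simps)
  moreover have "d (z + t / 2) > 0" using fx[of "z + t / 2"] z t \<delta> by (simp add: d_def)
  ultimately show False using d0 d1 d2 by linarith
qed

section \<open>Multivariate polynomials in at most one variable\<close>

text \<open>Other indeterminates are dropped, so this is faithful only under
  \<open>in_vars 1\<close>.\<close>

definition univariate :: "'a::comm_ring_1 mpoly \<Rightarrow> 'a poly" where
  "univariate p = (\<Sum>m \<in> Poly_Mapping.keys p. monom (Poly_Mapping.lookup p m) (Poly_Mapping.lookup m 0))"

lemma poly_univariate:
  assumes "in_vars 1 p"
  shows "eval_mpoly p x = poly (univariate p) (x 0)"
proof -
  have "(\<Prod>i \<in> Poly_Mapping.keys m. x i ^ Poly_Mapping.lookup m i) = x 0 ^ Poly_Mapping.lookup m 0"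
    if "m \<in> Poly_Mapping.keys p" for m
  proof -
    have "Poly_Mapping.keys m \<subseteq> {0}" using assms that by (auto simp: in_vars_def)
    then consider "Poly_Mapping.keys m = {}" | "Poly_Mapping.keys m = {0}" by blast
    then show ?thesis by cases (auto simp: in_keys_iff)
  qed
  then show ?thesis
    by (simp add: eval_mpoly_def univariate_def poly_sum poly_monom)
qed

text \<open>Allows summing over a fixed list of monomials even when some coefficients vanish, as in
  \<open>quadratic 0 1 1\<close>.\<close>

lemma eval_mpoly_superset:
  assumes "finite M" "Poly_Mapping.keys p \<subseteq> M"
  shows "eval_mpoly p x =
    (\<Sum>m \<in> M. Poly_Mapping.lookup p m * (\<Prod>i \<in> Poly_Mapping.keys m. x i ^ Poly_Mapping.lookup m i))"
  unfolding eval_mpoly_def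
  by (rule sum.mono_neutral_left) (use assms in \<open>auto simp: in_keys_iff\<close>)

definition quadratic :: "'a::comm_ring_1 \<Rightarrow> 'a \<Rightarrow> 'a \<Rightarrow> 'a mpoly" where
  "quadratic a b c = Poly_Mapping.single (Poly_Mapping.single 0 2) a
     + Poly_Mapping.single (Poly_Mapping.single 0 1) b + Poly_Mapping.single 0 c"

lemma keys_quadratic:
  "Poly_Mapping.keys (quadratic a b c) \<subseteq>
     {Poly_Mapping.single 0 2, Poly_Mapping.single 0 1, 0}"
  unfolding quadratic_def
  by (intro order_trans[OF Poly_Mapping.keys_add] Un_least) (auto simp del: single_numeral)

lemma in_vars_quadratic: "in_vars 1 (quadratic a b c)"
  using keys_quadratic[of a b c] by (fastforce simp: in_vars_def simp del: single_numeral split: if_splits)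

lemma eval_quadratic: "eval_mpoly (quadratic a b c) x = a * x 0 ^ 2 + b * x 0 + c"
proof -
  \<comment> \<open>The three monomials must be distinct for the sum to split and the lookups to
    separate.\<close>
  have ne: "Poly_Mapping.single 0 2 \<noteq> (Poly_Mapping.single 0 1 :: nat \<Rightarrow>\<^sub>0 nat)"
    "Poly_Mapping.single 0 1 \<noteq> (0 :: nat \<Rightarrow>\<^sub>0 nat)" "Poly_Mapping.single 0 2 \<noteq> (0 :: nat \<Rightarrow>\<^sub>0 nat)"
    by (metis lookup_single_eq lookup_zero one_neq_zero zero_neq_numeral numeral_eq_one_iff
        semiring_norm(85))+
  show ?thesis
    by (subst eval_mpoly_superset[OF _ keys_quadratic])
      (use ne ne[symmetric] in \<open>simp_all add: quadratic_def lookup_add lookup_single when_def add.assoc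
          del: single_numeral\<close>)
qed

section \<open>The rewrite system\<close>

abbreviation Zero :: "(nat, nat) trm" where "Zero \<equiv> Fun 0 []"
abbreviation S :: "(nat, nat) trm \<Rightarrow> (nat, nat) trm" where "S t \<equiv> Fun 1 [t]"
abbreviation F :: "(nat, nat) trm \<Rightarrow> (nat, nat) trm" where "F t \<equiv> Fun 2 [t]"
abbreviation G :: "(nat, nat) trm \<Rightarrow> (nat, nat) trm" where "G t \<equiv> Fun 3 [t]"
abbreviation X :: "(nat, nat) trm" where "X \<equiv> Var 0"

definition symbols :: "nat set" where "symbols = {0, 1, 2, 3}"

definition arity :: "nat \<Rightarrow> nat" where "arity f = (if f = 0 then 0 else 1)"

definition rules :: "(nat, nat) rule set" where
  "rules = {(S (S Zero), F Zero), (S (S (S Zero)), F (S Zero)), (F (S (S Zero)), (S ^^ 20) Zero),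
     (F X, X), (G (S X), S (S (G X))), (F (G X), G (G (F X))),
     ((G ^^ 5) (F (S (S X))), F (G (G X)))}"

lemma trs_rules: "trs symbols arity rules"
  by (simp add: trs_def symbols_def rules_def arity_def eval_nat_numeral)

lemma eval_trm_unary:
  assumes "in_vars 1 (I h)"
  shows "eval_trm I \<alpha> (Fun h [t]) = poly (univariate (I h)) (eval_trm I \<alpha> t)"
  using poly_univariate[OF assms] by simp

lemma eval_trm_unary_iterate:
  assumes "in_vars 1 (I h)"
  shows "eval_trm I \<alpha> (((\<lambda>t. Fun h [t]) ^^ n) t) = (poly (univariate (I h)) ^^ n) (eval_trm I \<alpha> t)"
  by (induction n) (simp_all add: eval_trm_unary[of I h, OF assms] del: eval_trm.simps)

lemma not_poly_terminating_field:
  "\<not> poly_terminating_field TYPE('a::linordered_field) symbols arity rules"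
proof
  assume "poly_terminating_field TYPE('a) symbols arity rules"
  then obtain \<delta> :: 'a and I :: "nat \<Rightarrow> 'a mpoly" where \<delta>: "\<delta> > 0"
    and vars: "\<And>h. h \<in> symbols \<Longrightarrow> in_vars (arity h) (I h)"
    and into: "\<And>h. h \<in> symbols \<Longrightarrow> maps_into {0..} (arity h) (I h)"
    and mono: "\<And>h. h \<in> symbols \<Longrightarrow> monotone_args {0..} (gt_delta \<delta>) (arity h) (I h)"
    and comp: "compatible {0..} (gt_delta \<delta>) I rules"
    unfolding poly_terminating_field_def by blast
  define P where "P h = univariate (I h)" for h
  \<comment> \<open>With no arguments, \<open>eval_trm\<close> supplies the default 0
    everywhere.\<close>
  define z where "z = eval_mpoly (I 0) (\<lambda>i. 0)"
  have vars1: "in_vars 1 (I h)" if "h \<in> {1, 2, 3}" for h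
    using vars[of h] that by (auto simp: symbols_def arity_def)
  have eval: "eval_trm I \<alpha> (Fun h [t]) = poly (P h) (eval_trm I \<alpha> t)"
    if "h \<in> {1, 2, 3}" for h \<alpha> and t :: "(nat, nat) trm"
    using eval_trm_unary[of I h, OF vars1[OF that]] by (simp add: P_def)
  have iter: "eval_trm I \<alpha> (((\<lambda>t. Fun h [t]) ^^ n) t) = (poly (P h) ^^ n) (eval_trm I \<alpha> t)"
    if "h \<in> {1, 2, 3}" for h n \<alpha> and t :: "(nat, nat) trm"
    using eval_trm_unary_iterate[of I h, OF vars1[OF that]] by (simp add: P_def)
  \<comment> \<open>Constant assignments suffice, since \<open>X\<close> is the only variable in the
    rules.\<close>
  have compat: "eval_trm I (\<lambda>_. x) l - eval_trm I (\<lambda>_. x) r \<ge> \<delta>"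
    if "(l, r) \<in> rules" "x \<ge> 0" for l r x
    using comp that by (fastforce simp: compatible_def gt_delta_def)
  have Zero: "eval_trm I \<alpha> Zero = z" for \<alpha> by (simp add: z_def)
  have X: "eval_trm I (\<lambda>_. x) X = x" for x by simp
  note compat' = compat[unfolded rules_def]
  note eval_simps = eval iter Zero X
  show False
  proof (rule no_field_interpretation[of \<delta> z "P 1" "P 2" "P 3"])
    show "z \<ge> 0" using into[of 0] by (auto simp: maps_into_def symbols_def arity_def z_def)
    show "poly p x \<ge> 0" if p: "p \<in> {P 1, P 2, P 3}" and x: "x \<ge> 0" for p x
    proof -
      obtain h where h: "h \<in> {1, 2, 3}" "p = P h" using p by blast
      have "maps_into {0..} 1 (I h)" using into[of h] h by (auto simp: symbols_def arity_def)
      then have "eval_mpoly (I h) (\<lambda>_. x) \<ge> 0" using x by (simp add: maps_into_def)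
      then show ?thesis using poly_univariate[OF vars1[OF h(1)]] h by (simp add: P_def)
    qed
    show "poly p y - poly p x \<ge> \<delta>"
      if p: "p \<in> {P 1, P 2, P 3}" and x: "x \<ge> 0" and y: "y - x \<ge> \<delta>" for p x y
    proof -
      obtain h where h: "h \<in> {1, 2, 3}" "p = P h" using p by blast
      have "monotone_args {0..} (gt_delta \<delta>) 1 (I h)"
        using mono[of h] h by (auto simp: symbols_def arity_def)
      moreover have "y \<ge> 0" using x y \<delta> by simp
      ultimately have "eval_mpoly (I h) ((\<lambda>_. x)(0 := y)) - eval_mpoly (I h) (\<lambda>_. x) \<ge> \<delta>"
        using x y by (simp add: monotone_args_def gt_delta_def)
      then show ?thesis using poly_univariate[OF vars1[OF h(1)]] h by (simp add: P_def)
    qed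
    show "poly (P 1) (poly (P 1) z) - poly (P 2) z \<ge> \<delta>"
      using compat'[of "S (S Zero)" "F Zero" 0] by (simp add: eval_simps del: eval_trm.simps)
    show "poly (P 1) (poly (P 1) (poly (P 1) z)) - poly (P 2) (poly (P 1) z) \<ge> \<delta>"
      using compat'[of "S (S (S Zero))" "F (S Zero)" 0] by (simp add: eval_simps del: eval_trm.simps)
    show "poly (P 2) (poly (P 1) (poly (P 1) z)) - (poly (P 1) ^^ 20) z \<ge> \<delta>"
      using compat'[of "F (S (S Zero))" "(S ^^ 20) Zero" 0]
      by (simp add: eval_simps del: eval_trm.simps)
    fix x :: 'a assume x: "x \<ge> 0"
    show "poly (P 2) x - x \<ge> \<delta>"
      using compat'[of "F X" X, OF _ x] by (simp add: eval_simps del: eval_trm.simps)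
    show "poly (P 3) (poly (P 1) x) - poly (P 1) (poly (P 1) (poly (P 3) x)) \<ge> \<delta>"
      using compat'[of "G (S X)" "S (S (G X))", OF _ x] by (simp add: eval_simps del: eval_trm.simps)
    show "poly (P 2) (poly (P 3) x) - poly (P 3) (poly (P 3) (poly (P 2) x)) \<ge> \<delta>"
      using compat'[of "F (G X)" "G (G (F X))", OF _ x] by (simp add: eval_simps del: eval_trm.simps)
    show "(poly (P 3) ^^ 5) (poly (P 2) (poly (P 1) (poly (P 1) x)))
        - poly (P 2) (poly (P 3) (poly (P 3) x)) \<ge> \<delta>"
      using compat'[of "(G ^^ 5) (F (S (S X)))" "F (G (G X))", OF _ x]
      by (simp add: eval_simps del: eval_trm.simps)
  qed (rule \<delta>)
qed

section \<open>The interpretation over the naturals\<close>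

definition interp :: "nat \<Rightarrow> int mpoly" where
  "interp h = (if h = 0 then 0 else if h = 1 then quadratic 0 1 1
     else if h = 2 then quadratic 9 (- 8) 1 else quadratic 0 3 2)"

lemma eval_interp:
  "eval_trm interp \<alpha> Zero = 0"
  "eval_trm interp \<alpha> (S t) = eval_trm interp \<alpha> t + 1"
  "eval_trm interp \<alpha> (F t) = 9 * (eval_trm interp \<alpha> t)\<^sup>2 - 8 * eval_trm interp \<alpha> t + 1"
  "eval_trm interp \<alpha> (G t) = 3 * eval_trm interp \<alpha> t + 2"
  by (simp_all add: interp_def eval_quadratic) (simp add: eval_mpoly_def)

text \<open>After shifting by 1, the interpretation of \<open>G\<close> is multiplication by
  3.\<close>

lemma eval_interp_iterate:
  "eval_trm interp \<alpha> ((S ^^ n) t) = eval_trm interp \<alpha> t + int n"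
  "eval_trm interp \<alpha> ((G ^^ n) t) = 3 ^ n * (eval_trm interp \<alpha> t + 1) - 1"
  by (induction n) (simp_all add: eval_interp algebra_simps del: eval_trm.simps(2) One_nat_def)

text \<open>The difference factors, and integrality gives \<open>x + y \<ge> 1\<close>, so the
  second factor is positive.\<close>

lemma interp_f_increasing:
  fixes x y :: int
  assumes "0 \<le> x" "x < y"
  shows "9 * x\<^sup>2 - 8 * x < 9 * y\<^sup>2 - 8 * y"
proof -
  have "(y - x) * (9 * (x + y) - 8) > 0" using assms by (intro mult_pos_pos) auto
  then show ?thesis by (simp add: algebra_simps power2_eq_square)
qed

text \<open>The difference of the two sides is \<open>9 * x * (x - 1) + 1\<close>, and no integer
  lies strictly between 0 and 1.\<close>

lemma interp_f_gt: "9 * x\<^sup>2 - 8 * x + 1 > (x :: int)" if "x \<ge> 0"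
proof (cases "x = 0")
  case False
  then have "x * (x - 1) \<ge> 0" using that by (intro mult_nonneg_nonneg) auto
  then show ?thesis by (simp add: algebra_simps power2_eq_square)
qed simp

lemma poly_terminating_nat_rules: "poly_terminating_nat symbols arity rules"
  unfolding poly_terminating_nat_def
proof (intro exI[of _ interp] conjI ballI)
  fix h assume h: "h \<in> symbols"
  show "in_vars (arity h) (interp h)"
    by (simp add: interp_def arity_def in_vars_quadratic[simplified]) (simp add: in_vars_def)
  have f_nonneg: "9 * x\<^sup>2 - 8 * x + 1 \<ge> 0" if "x \<ge> 0" for x :: int
    using interp_f_gt[OF that] that by linarith
  show "maps_into \<nat> (arity h) (interp h)"
    using f_nonneg
    by (auto simp: interp_def arity_def maps_into_def eval_quadratic eval_mpoly_def[of 0]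
        Nats_altdef1)
  show "monotone_args \<nat> (>) (arity h) (interp h)"
    using interp_f_increasing[THEN zless_imp_add1_zle]
    by (auto simp: interp_def arity_def monotone_args_def eval_quadratic Nats_altdef1)
next
  show "compatible \<nat> (>) interp rules"
    unfolding compatible_def
  proof clarify
    fix l r and \<alpha> :: "nat \<Rightarrow> int"
    assume lr: "(l, r) \<in> rules" and \<alpha>: "\<forall>v. \<alpha> v \<in> \<nat>"
    have x: "\<alpha> 0 \<ge> 0" using \<alpha> by (simp add: Nats_altdef1)
    show "eval_trm interp \<alpha> r < eval_trm interp \<alpha> l"
      \<comment> \<open>\<open>F\<close> takes the values 1, 2, 21 at 0, 1, 2, against 2, 3, 20 in
        the ground rules. For \<open>F (G X)\<close> the squares cancel, leaving 156x + 4; in the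
        last rule a positive multiple of the square remains.\<close>
      using lr x interp_f_gt[OF x] zero_le_power2[of "\<alpha> 0"] unfolding rules_def
      by (auto simp: eval_interp eval_interp_iterate power2_eq_square algebra_simps
          simp del: eval_trm.simps(2) One_nat_def)
  qed
qed

theorem theorem4p7:
  "\<exists>(F :: nat set) (ar :: nat \<Rightarrow> nat) (R :: (nat, nat) rule set).
     trs F ar R \<and> poly_terminating_nat F ar R \<and>
     \<not> poly_terminating_field TYPE(real) F ar R \<and>
     \<not> poly_terminating_field TYPE(rat) F ar R"
  using trs_rules poly_terminating_nat_rules not_poly_terminating_field[where ?'a = real]
    not_poly_terminating_field[where ?'a = rat] by blast

end
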